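(* For all $n \geq 29$, \[\mathrm{ex}_o(n,R_4) = \left\lfloor \frac{n}{3} \right\rfloor \binom{\lceil 2n/3 \rceil}{2},\] and for all $n \geq 70$, \[\mathrm{ex}(n,R_4) = \left\lfloor \frac{n}{3} \right\rfloor \binom{\lceil 2n/3 \rceil}{2}.\] Moreover, in each case (oriented and standard) the extremal graphs, i.e. the $R_4$-free graphs on $n$ vertices attaining this number of edges, are unique up to isomorphism when $n \equiv 0,1 \pmod 3$, and there are exactly two of them up to isomorphism when $n \equiv 2 \pmod 3$.
   Context: A $2\to1$ directed hypergraph (here simply a "graph") is a pair $H=(V,E)$ with $V$ a finite vertex set and $E$ a set of edges, each edge being a 3-element subset $\{a,b,c\}$ of $V$ with one element marked as the head; the edge with underlying set $\{a,b,c\}$ and head $c$ is written $ab \to c$ (and $\{a,b\}$ is its tail set). A triple may carry up to three distinct edges (one for each choice of head). $H$ is oriented if every 3-subset of $V$ carries at most one edge. A homomorphism $\phi:F\to G$ is a map $V(F)\to V(G)$ with $ab\to c\in E(F)\Rightarrow \phi(a)\phi(b)\to\phi(c)\in E(G)$. $G$ is $F$-free if there is no injective homomorphism $F\to G$. $\mathrm{ex}(n,F)$ is the maximum number of edges of an $F$-free graph on $n$ vertices, and $\mathrm{ex}_o(n,F)$ is the maximum number of edges of an $F$-free oriented graph on $n$ vertices. $R_4$ is the graph with vertex set $\{a,b,c,d,e\}$ and edge set $\{ab\to c,\ cd\to e\}$. *)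

theory Defs
  imports Complex_Main
begin

text \<open>An edge is a pair \<open>(S, h)\<close> of its underlying 3-set and its head \<open>h \<in> S\<close>.\<close>

record 'a dhgraph =
  verts :: "'a set"
  edges :: "('a set \<times> 'a) set"

definition dhgraph :: "'a dhgraph \<Rightarrow> bool" where
  "dhgraph H \<longleftrightarrow> finite (verts H) \<and>
     (\<forall>(S, h) \<in> edges H. S \<subseteq> verts H \<and> card S = 3 \<and> h \<in> S)"

text \<open>The edge \<open>ab \<rightarrow> c\<close>. If \<open>a, b, c\<close> are not pairwise distinct, then \<open>arrow a b c\<close> is never
  an edge of a graph, since its first component does not have three elements.\<close>

definition arrow :: "'a \<Rightarrow> 'a \<Rightarrow> 'a \<Rightarrow> 'a set \<times> 'a" where
  "arrow a b c = ({a, b, c}, c)"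

definition oriented :: "'a dhgraph \<Rightarrow> bool" where
  "oriented H \<longleftrightarrow>
     (\<forall>S. S \<subseteq> verts H \<and> card S = 3 \<longrightarrow> card {e \<in> edges H. fst e = S} \<le> 1)"

definition dh_hom :: "('a \<Rightarrow> 'b) \<Rightarrow> 'a dhgraph \<Rightarrow> 'b dhgraph \<Rightarrow> bool" where
  "dh_hom \<phi> F G \<longleftrightarrow> \<phi> ` verts F \<subseteq> verts G \<and>
     (\<forall>a b c. arrow a b c \<in> edges F \<longrightarrow> arrow (\<phi> a) (\<phi> b) (\<phi> c) \<in> edges G)"

definition dh_free :: "'a dhgraph \<Rightarrow> 'b dhgraph \<Rightarrow> bool" where
  "dh_free F G \<longleftrightarrow> \<not> (\<exists>\<phi>. dh_hom \<phi> F G \<and> inj_on \<phi> (verts F))"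

definition dh_iso :: "'a dhgraph \<Rightarrow> 'b dhgraph \<Rightarrow> bool" where
  "dh_iso G H \<longleftrightarrow> (\<exists>\<phi>. bij_betw \<phi> (verts G) (verts H) \<and>
     (\<forall>a \<in> verts G. \<forall>b \<in> verts G. \<forall>c \<in> verts G.
        arrow a b c \<in> edges G \<longleftrightarrow> arrow (\<phi> a) (\<phi> b) (\<phi> c) \<in> edges H))"

text \<open>Every finite graph is isomorphic to one with vertices in \<open>nat\<close>, so it is enough to
  consider the latter.\<close>

definition free_graphs :: "nat \<Rightarrow> 'a dhgraph \<Rightarrow> nat dhgraph set" where
  "free_graphs n F = {G. dhgraph G \<and> card (verts G) = n \<and> dh_free F G}"

definition free_oriented_graphs :: "nat \<Rightarrow> 'a dhgraph \<Rightarrow> nat dhgraph set" where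
  "free_oriented_graphs n F = {G. dhgraph G \<and> oriented G \<and> card (verts G) = n \<and> dh_free F G}"

definition ex_std :: "nat \<Rightarrow> 'a dhgraph \<Rightarrow> nat" where
  "ex_std n F = Max ((\<lambda>G. card (edges G)) ` free_graphs n F)"

definition ex_ori :: "nat \<Rightarrow> 'a dhgraph \<Rightarrow> nat" where
  "ex_ori n F = Max ((\<lambda>G. card (edges G)) ` free_oriented_graphs n F)"

definition extremal_std :: "nat \<Rightarrow> 'a dhgraph \<Rightarrow> nat dhgraph set" where
  "extremal_std n F = {G \<in> free_graphs n F. card (edges G) = ex_std n F}"

definition extremal_ori :: "nat \<Rightarrow> 'a dhgraph \<Rightarrow> nat dhgraph set" where
  "extremal_ori n F = {G \<in> free_oriented_graphs n F. card (edges G) = ex_ori n F}"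

definition num_iso_classes :: "'a dhgraph set \<Rightarrow> nat" where
  "num_iso_classes A = card (A // {(G, H). G \<in> A \<and> H \<in> A \<and> dh_iso G H})"

text \<open>The vertices \<open>a, b, c, d, e\<close> are \<open>0, 1, 2, 3, 4\<close>.\<close>

definition R4 :: "nat dhgraph" where
  "R4 = \<lparr>verts = {0, 1, 2, 3, 4}, edges = {arrow 0 1 2, arrow 2 3 4}\<rparr>"

end

theory Submission imports Defs begin

text \<open>In an \<open>R4\<close>-free graph the pairs pointing to a vertex \<open>v\<close> and the pairs that together with
  \<open>v\<close> carry an edge not headed by \<open>v\<close> are cross-intersecting. So a vertex that is a head of some
  edge and a tail of another one lies in at most \<open>2n\<close> (oriented) or \<open>4n\<close> (standard) edges. Let
  \<open>C\<close> be the set of these vertices, \<open>A\<close> the vertices that are never heads and \<open>B\<close> those that are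
  only heads. Edges avoiding \<open>C\<close> point from pairs in \<open>A\<close> to \<open>B\<close>, so there are at most
  \<open>|B| (|A| choose 2)\<close> of them. Writing \<open>g n\<close> for the maximum of \<open>b (a choose 2)\<close> over
  \<open>a + b = n\<close>, the ratio \<open>g n / n\<close> is nondecreasing and exceeds the degree bound in the stated
  range of \<open>n\<close>; hence a nonempty \<open>C\<close> is never optimal. For empty \<open>C\<close> only the maximisation of
  \<open>b (a choose 2)\<close> remains, which has two solutions exactly when \<open>n mod 3 = 2\<close>.\<close>

section \<open>Cross-intersecting families of pairs\<close>

text \<open>An intersecting family of pairs is a star or a triangle. The star with centre
  \<open>x\<close> is covered by the pairs \<open>{x, w}\<close> with \<open>w\<close> in
  \<open>W\<close>, and the 3 pairs of a triangle are absorbed by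
  \<open>3 \<le> card W\<close>.\<close>

lemma card_intersecting_pairs:
  assumes W: "finite W" "3 \<le> card W"
    and F: "\<And>P. P \<in> F \<Longrightarrow> P \<subseteq> W \<and> card P = 2"
    and int: "\<And>P Q. P \<in> F \<Longrightarrow> Q \<in> F \<Longrightarrow> P \<inter> Q \<noteq> {}"
  shows "card F \<le> card W"
proof -
  have star: "card F \<le> card W" if x: "\<And>P. P \<in> F \<Longrightarrow> x \<in> P" for x
  proof -
    have "F \<subseteq> (\<lambda>w. {x, w}) ` W"
    proof
      fix P assume P: "P \<in> F"
      then obtain a b where "P = {a, b}" using F[OF P] by (auto simp: card_2_iff)
      then show "P \<in> (\<lambda>w. {x, w}) ` W" using x[OF P] F[OF P] by auto
    qed
    then show ?thesis using W by (intro surj_card_le)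
  qed
  show ?thesis
  proof (cases "F = {}")
    case False
    then obtain R where R: "R \<in> F" by blast
    then obtain x y where xy: "R = {x, y}" "x \<noteq> y" using F[OF R] by (auto simp: card_2_iff)
    show ?thesis
    \<comment> \<open>If neither end of \<open>R\<close> is common to all members, some
      \<open>P\<close> avoids \<open>x\<close> and some \<open>Q\<close> avoids \<open>y\<close>.
      Meeting \<open>R\<close> and each other forces \<open>P = {y, z}\<close> and
      \<open>Q = {x, z}\<close>, and a pair that meets all three sides lies in this
      triangle.\<close>
    proof (cases "(\<forall>P\<in>F. x \<in> P) \<or> (\<forall>P\<in>F. y \<in> P)")
      case True
      then show ?thesis using star by blast
    next
      case False
      then obtain P Q where PQ: "P \<in> F" "x \<notin> P" "Q \<in> F" "y \<notin> Q" by blast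
      have "y \<in> P" using int[OF PQ(1) R] PQ(2) xy by auto
      then obtain z where z: "P = {y, z}" "y \<noteq> z" using F[OF PQ(1)] by (auto simp: card_2_iff)
      have "x \<in> Q" using int[OF PQ(3) R] PQ(4) xy by auto
      then obtain z' where "Q = {x, z'}" "x \<noteq> z'" using F[OF PQ(3)] by (auto simp: card_2_iff)
      then have Q: "Q = {x, z}" using int[OF PQ(3) PQ(1)] z PQ by auto
      have "F \<subseteq> {{x, y}, {y, z}, {x, z}}"
      proof
        fix S assume S: "S \<in> F"
        then obtain a b where "S = {a, b}" "a \<noteq> b" using F[OF S] by (auto simp: card_2_iff)
        moreover have "S \<inter> {x, y} \<noteq> {}" "S \<inter> {y, z} \<noteq> {}" "S \<inter> {x, z} \<noteq> {}"
          using int[OF S R] int[OF S PQ(1)] int[OF S PQ(3)] xy z Q by simp_all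
        ultimately show "S \<in> {{x, y}, {y, z}, {x, z}}" using xy z PQ by auto
      qed
      then have "card F \<le> card {{x, y}, {y, z}, {x, z}}" by (rule card_mono[rotated]) simp
      also have "\<dots> \<le> 3" by (simp add: card_insert_if)
      finally show ?thesis using W by simp
    qed
  qed simp
qed

text \<open>Choose a point of \<open>Q\<close> in the pair first, then the other point: 2 times
  \<open>card W - 1\<close> choices cover everything.\<close>

lemma card_pairs_meeting_pair:
  assumes W: "finite W"
    and F: "\<And>P. P \<in> F \<Longrightarrow> P \<subseteq> W \<and> card P = 2"
    and Q: "Q \<subseteq> W" "card Q = 2"
    and int: "\<And>P. P \<in> F \<Longrightarrow> P \<inter> Q \<noteq> {}"
  shows "card F \<le> 2 * (card W - 1)"
proof -
  have finQ: "finite Q" using Q(2) card.infinite by fastforce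
  have "F \<subseteq> (\<lambda>(x, y). {x, y}) ` (SIGMA x:Q. W - {x})"
  proof
    fix P assume P: "P \<in> F"
    then obtain a b where ab: "P = {a, b}" "a \<noteq> b" using F[OF P] by (auto simp: card_2_iff)
    then have "a \<in> Q \<or> b \<in> Q" using int[OF P] by auto
    then show "P \<in> (\<lambda>(x, y). {x, y}) ` (SIGMA x:Q. W - {x})"
    proof
      assume "a \<in> Q"
      then have "(a, b) \<in> (SIGMA x:Q. W - {x})" using ab F[OF P] by auto
      then show ?thesis using ab by force
    next
      assume "b \<in> Q"
      then have "(b, a) \<in> (SIGMA x:Q. W - {x})" using ab F[OF P] by auto
      then show ?thesis using ab by (force simp: insert_commute)
    qed
  qed
  moreover have fin: "finite (SIGMA x:Q. W - {x})" using W finQ by auto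
  ultimately have "card F \<le> card (SIGMA x:Q. W - {x})"
    by (intro surj_card_le)
  also have "\<dots> = (\<Sum>x\<in>Q. card (W - {x}))" using finQ W by simp
  also have "\<dots> = (\<Sum>x\<in>Q. card W - 1)" using Q by (intro sum.cong) auto
  finally show ?thesis using Q by simp
qed

text \<open>Such a pair takes one point from \<open>P\<close> and the other from \<open>Q\<close>,
  since no point serves for both.\<close>

lemma card_pairs_meeting_disjoint_pairs:
  assumes F: "\<And>R. R \<in> F \<Longrightarrow> card R = 2 \<and> R \<inter> P \<noteq> {} \<and> R \<inter> Q \<noteq> {}"
    and P: "card P = 2" and Q: "card Q = 2" and disj: "P \<inter> Q = {}"
  shows "card F \<le> 4"
proof -
  have fin: "finite P" "finite Q" using P Q card.infinite by fastforce+
  have "F \<subseteq> (\<lambda>(x, y). {x, y}) ` (P \<times> Q)"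
  proof
    fix R assume R: "R \<in> F"
    then obtain a b where ab: "R = {a, b}" "a \<noteq> b" using F[OF R] by (auto simp: card_2_iff)
    then have "(a \<in> P \<and> b \<in> Q) \<or> (b \<in> P \<and> a \<in> Q)" using F[OF R] disj by auto
    then show "R \<in> (\<lambda>(x, y). {x, y}) ` (P \<times> Q)" using ab by (force simp: insert_commute)
  qed
  then have "card F \<le> card (P \<times> Q)"
    using fin by (intro surj_card_le) auto
  then show ?thesis using P Q by (simp add: card_cartesian_product)
qed

text \<open>If one family has two disjoint members, the other has at most 4, and a fixed member of
  the other bounds the first by \<open>2 * (card W - 1)\<close>. Otherwise both are intersecting and
  have at most \<open>card W\<close> members. The weight 2 in the second bound anticipates that a
  pair in an out-link can carry two edges.\<close>

lemma card_cross_intersecting_pairs: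
  assumes W: "finite W" "3 \<le> card W"
    and F: "\<And>P. P \<in> F \<Longrightarrow> P \<subseteq> W \<and> card P = 2" and F0: "F \<noteq> {}"
    and G: "\<And>P. P \<in> G \<Longrightarrow> P \<subseteq> W \<and> card P = 2" and G0: "G \<noteq> {}"
    and int: "\<And>P Q. P \<in> F \<Longrightarrow> Q \<in> G \<Longrightarrow> P \<inter> Q \<noteq> {}"
  shows "card F + card G \<le> 2 * (card W + 1)" "card F + 2 * card G \<le> 4 * (card W + 1)"
proof -
  obtain P0 Q0 where PQ0: "P0 \<in> F" "Q0 \<in> G" using F0 G0 by blast
  have bF: "card F \<le> 2 * (card W - 1)"
    using F G[OF PQ0(2)] int PQ0 by (intro card_pairs_meeting_pair[OF W(1), of F Q0]) auto
  have bG: "card G \<le> 2 * (card W - 1)"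
    using G F[OF PQ0(1)] int PQ0 by (intro card_pairs_meeting_pair[OF W(1), of G P0]) blast+
  have "card F \<le> 4 \<or> card G \<le> 4 \<or> (card F \<le> card W \<and> card G \<le> card W)"
  proof (cases "\<exists>P\<in>F. \<exists>Q\<in>F. P \<inter> Q = {}")
    case True
    then obtain P Q where PQ: "P \<in> F" "Q \<in> F" "P \<inter> Q = {}" by blast
    have "card G \<le> 4"
      using F PQ G int by (intro card_pairs_meeting_disjoint_pairs[of G P Q]) blast+
    then show ?thesis by simp
  next
    case F': False
    show ?thesis
    proof (cases "\<exists>P\<in>G. \<exists>Q\<in>G. P \<inter> Q = {}")
      case True
      then obtain P Q where PQ: "P \<in> G" "Q \<in> G" "P \<inter> Q = {}" by blast
      have "card F \<le> 4"
        using F PQ G int by (intro card_pairs_meeting_disjoint_pairs[of F P Q]) blast+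
      then show ?thesis by simp
    next
      case False
      have "card F \<le> card W" using F F' by (intro card_intersecting_pairs[OF W]) blast+
      moreover have "card G \<le> card W" using G False by (intro card_intersecting_pairs[OF W]) blast+
      ultimately show ?thesis by simp
    qed
  qed
  then show "card F + card G \<le> 2 * (card W + 1)" "card F + 2 * card G \<le> 4 * (card W + 1)"
    using bF bG W(2) by auto
qed

section \<open>Links in \<open>R4\<close>-free graphs\<close>

lemma arrow_image: "arrow (f a) (f b) (f c) = map_prod (image f) f (arrow a b c)"
  by (simp add: arrow_def)

lemma dh_hom_R4_iff:
  "dh_hom \<phi> R4 G \<longleftrightarrow> {\<phi> 0, \<phi> 1, \<phi> 2, \<phi> 3, \<phi> 4} \<subseteq> verts G \<and>
     arrow (\<phi> 0) (\<phi> 1) (\<phi> 2) \<in> edges G \<and> arrow (\<phi> 2) (\<phi> 3) (\<phi> 4) \<in> edges G"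
proof -
  \<comment> \<open>Each edge is an arrow in two ways, as its tails can be swapped. Quantifying over
    edges instead of triples leaves just the two edges of \<open>R4\<close> to check.\<close>
  have *: "(\<forall>a b c. arrow a b c \<in> X \<longrightarrow> arrow (\<phi> a) (\<phi> b) (\<phi> c) \<in> edges G) \<longleftrightarrow>
     (\<forall>e\<in>X. map_prod (image \<phi>) \<phi> e \<in> edges G)" if "X = edges R4" for X
    unfolding arrow_image that by (auto simp: R4_def)
  show ?thesis
    unfolding dh_hom_def *[OF refl] by (auto simp: R4_def arrow_image)
qed

definition in_link :: "'a dhgraph \<Rightarrow> 'a \<Rightarrow> 'a set set" where
  "in_link G v = {S - {v} | S. (S, v) \<in> edges G}"

text \<open>The head is forgotten, so a pair stands for one or two edges, and for exactly one in an
  oriented graph.\<close>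

definition out_link :: "'a dhgraph \<Rightarrow> 'a \<Rightarrow> 'a set set" where
  "out_link G v = {S - {v} | S h. (S, h) \<in> edges G \<and> v \<in> S \<and> h \<noteq> v}"

lemma dhgraph_edgeD:
  assumes "dhgraph G" "(S, h) \<in> edges G"
  shows "S \<subseteq> verts G" "card S = 3" "h \<in> S" "finite S"
proof -
  have "finite (verts G)" "S \<subseteq> verts G \<and> card S = 3 \<and> h \<in> S"
    using assms by (auto simp: dhgraph_def)
  then show "S \<subseteq> verts G" "card S = 3" "h \<in> S" "finite S" by (auto intro: finite_subset)
qed

lemma finite_edges: "dhgraph G \<Longrightarrow> finite (edges G)"
  by (rule finite_subset[of _ "Pow (verts G) \<times> verts G"]) (auto simp: dhgraph_def)

lemma link_pairs:
  assumes "dhgraph G"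
  shows "P \<in> in_link G v \<Longrightarrow> P \<subseteq> verts G - {v} \<and> card P = 2"
    and "P \<in> out_link G v \<Longrightarrow> P \<subseteq> verts G - {v} \<and> card P = 2"
proof -
  have *: "S - {v} \<subseteq> verts G - {v} \<and> card (S - {v}) = 2" if "(S, h) \<in> edges G" "v \<in> S" for S h
    using dhgraph_edgeD[OF assms that(1)] that(2) by auto
  show "P \<subseteq> verts G - {v} \<and> card P = 2" if "P \<in> in_link G v"
    using that * dhgraph_edgeD(3)[OF assms] unfolding in_link_def by blast
  show "P \<subseteq> verts G - {v} \<and> card P = 2" if "P \<in> out_link G v"
    using that * unfolding out_link_def by blast
qed

text \<open>Disjoint members would give a copy of \<open>R4\<close> whose middle vertex, head of one
  edge and tail of the other, is \<open>v\<close>.\<close>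

lemma links_cross_intersecting:
  assumes G: "dhgraph G" and free: "dh_free R4 G"
    and P: "P \<in> in_link G v" and Q: "Q \<in> out_link G v"
  shows "P \<inter> Q \<noteq> {}"
proof
  assume disj: "P \<inter> Q = {}"
  obtain S where S: "(S, v) \<in> edges G" "P = S - {v}" using P by (auto simp: in_link_def)
  obtain T h where T: "(T, h) \<in> edges G" "v \<in> T" "h \<noteq> v" "Q = T - {v}"
    using Q by (auto simp: out_link_def)
  obtain a b where ab: "P = {a, b}" "a \<noteq> b"
    using link_pairs(1)[OF G P] by (auto simp: card_2_iff)
  have "h \<in> Q" using T dhgraph_edgeD[OF G T(1)] by auto
  then obtain d where d: "Q = {d, h}" "d \<noteq> h"
    using link_pairs(2)[OF G Q] by (auto simp: card_2_iff)
  have S': "S = {a, b, v}" and T': "T = {v, d, h}"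
    using S T ab d dhgraph_edgeD[OF G S(1)] by auto
  \<comment> \<open>Indexing a list turns injectivity on the vertices of \<open>R4\<close> into
    distinctness of the list.\<close>
  define \<phi> :: "nat \<Rightarrow> 'a" where "\<phi> = (!) [a, b, v, d, h]"
  have \<phi>: "\<phi> 0 = a" "\<phi> 1 = b" "\<phi> 2 = v" "\<phi> 3 = d" "\<phi> 4 = h" by (simp_all add: \<phi>_def)
  have "dh_hom \<phi> R4 G"
    using S T S' T' dhgraph_edgeD[OF G S(1)] dhgraph_edgeD[OF G T(1)]
    unfolding dh_hom_R4_iff \<phi> by (auto simp: arrow_def)
  moreover have "inj_on \<phi> (verts R4)"
  proof -
    have "v \<notin> {a, b, d, h}" using S T ab d by blast
    then have "distinct [a, b, v, d, h]" using ab d disj by auto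
    then show ?thesis unfolding \<phi>_def by (rule inj_on_nth) (auto simp: R4_def)
  qed
  ultimately show False using free by (auto simp: dh_free_def)
qed

lemma card_in_edges:
  "card {e \<in> edges G. snd e = v} = card (in_link G v)" if G: "dhgraph G"
proof -
  have "inj_on (\<lambda>e. fst e - {v}) {e \<in> edges G. snd e = v}"
    using dhgraph_edgeD(3)[OF G] by (auto simp: inj_on_def)
  moreover have "(\<lambda>e. fst e - {v}) ` {e \<in> edges G. snd e = v} = in_link G v"
    by (force simp: in_link_def)
  ultimately show ?thesis by (simp flip: card_image)
qed

lemma finite_out_link: "dhgraph G \<Longrightarrow> finite (out_link G v)"
  by (rule finite_subset[of _ "Pow (verts G)"]) (auto simp: dhgraph_def out_link_def)

lemma card_out_edges:
  assumes G: "dhgraph G"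
  shows "card {e \<in> edges G. v \<in> fst e \<and> snd e \<noteq> v} \<le> 2 * card (out_link G v)"
proof -
  have fin: "finite P" if "P \<in> out_link G v" for P
    using link_pairs(2)[OF G that] by (metis card.infinite zero_neq_numeral)
  have "{e \<in> edges G. v \<in> fst e \<and> snd e \<noteq> v}
      \<subseteq> (\<lambda>(P, h). (insert v P, h)) ` (SIGMA P:out_link G v. P)"
  proof
    fix e assume e: "e \<in> {e \<in> edges G. v \<in> fst e \<and> snd e \<noteq> v}"
    obtain S h where Sh: "e = (S, h)" by (cases e)
    have "(S - {v}, h) \<in> (SIGMA P:out_link G v. P)"
      using e dhgraph_edgeD(3)[OF G, of S h] by (auto simp: Sh out_link_def)
    moreover have "e = (\<lambda>(P, h). (insert v P, h)) (S - {v}, h)" using e Sh by auto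
    ultimately show "e \<in> (\<lambda>(P, h). (insert v P, h)) ` (SIGMA P:out_link G v. P)" by blast
  qed
  then have "card {e \<in> edges G. v \<in> fst e \<and> snd e \<noteq> v} \<le> card (SIGMA P:out_link G v. P)"
    using fin finite_out_link[OF G, of v] by (intro surj_card_le) auto
  also have "\<dots> = (\<Sum>P\<in>out_link G v. card P)"
    using fin finite_out_link[OF G, of v] by simp
  also have "\<dots> = (\<Sum>P\<in>out_link G v. 2)"
    using link_pairs(2)[OF G] by (intro sum.cong) auto
  finally show ?thesis by simp
qed

lemma oriented_eqD:
  assumes "dhgraph G" "oriented G" "(S, h) \<in> edges G" "(S, h') \<in> edges G"
  shows "h = h'"
proof -
  have "card {e \<in> edges G. fst e = S} \<le> 1"
    using assms dhgraph_edgeD[OF assms(1,3)] by (auto simp: oriented_def)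
  moreover have "finite {e \<in> edges G. fst e = S}" using finite_edges[OF assms(1)] by simp
  ultimately have "(S, h) = (S, h')" using assms(3,4)
    by (auto simp only: card_le_Suc0_iff_eq One_nat_def mem_Collect_eq fst_conv)
  then show ?thesis by simp
qed

lemma card_out_edges_oriented:
  assumes G: "dhgraph G" and o: "oriented G"
  shows "card {e \<in> edges G. v \<in> fst e \<and> snd e \<noteq> v} \<le> card (out_link G v)"
proof (rule card_inj_on_le)
  show "inj_on (\<lambda>e. fst e - {v}) {e \<in> edges G. v \<in> fst e \<and> snd e \<noteq> v}"
  proof (rule inj_onI)
    fix e f assume *: "e \<in> {e \<in> edges G. v \<in> fst e \<and> snd e \<noteq> v}"
      "f \<in> {e \<in> edges G. v \<in> fst e \<and> snd e \<noteq> v}" "fst e - {v} = fst f - {v}"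
    then have "fst e = fst f" by auto
    then show "e = f" using * oriented_eqD[OF G o] by (cases e; cases f) auto
  qed
  show "(\<lambda>e. fst e - {v}) ` {e \<in> edges G. v \<in> fst e \<and> snd e \<noteq> v} \<subseteq> out_link G v"
    by (force simp: out_link_def)
qed (rule finite_out_link[OF G])

text \<open>The two links are nonempty cross-intersecting families of pairs in
  \<open>verts G - {v}\<close>. Out-pairs count once in the oriented case and at most twice in
  general, which matches the two bounds for such families.\<close>

lemma card_edges_at_mixed_vertex:
  assumes G: "dhgraph G" and free: "dh_free R4 G" and v: "v \<in> verts G"
    and n: "4 \<le> card (verts G)" and ne: "in_link G v \<noteq> {}" "out_link G v \<noteq> {}"
  shows "card {e \<in> edges G. v \<in> fst e} \<le> 4 * card (verts G)"
    and "oriented G \<Longrightarrow> card {e \<in> edges G. v \<in> fst e} \<le> 2 * card (verts G)"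
proof -
  have fin: "finite (verts G)" using G by (simp add: dhgraph_def)
  have W: "finite (verts G - {v})" "3 \<le> card (verts G - {v})" "card (verts G - {v}) + 1 = card (verts G)"
    using n v fin by auto
  have b: "card (in_link G v) + card (out_link G v) \<le> 2 * card (verts G)"
    "card (in_link G v) + 2 * card (out_link G v) \<le> 4 * card (verts G)"
    using card_cross_intersecting_pairs[OF W(1,2) _ ne(1) _ ne(2)] link_pairs[OF G]
      links_cross_intersecting[OF G free] unfolding W(3) by simp_all
  have "{e \<in> edges G. v \<in> fst e} = {e \<in> edges G. snd e = v} \<union> {e \<in> edges G. v \<in> fst e \<and> snd e \<noteq> v}"
    using dhgraph_edgeD(3)[OF G] by auto
  then have le: "card {e \<in> edges G. v \<in> fst e}
      \<le> card {e \<in> edges G. snd e = v} + card {e \<in> edges G. v \<in> fst e \<and> snd e \<noteq> v}"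
    by (simp only: card_Un_le)
  show "card {e \<in> edges G. v \<in> fst e} \<le> 4 * card (verts G)"
    using le card_in_edges[OF G, of v] card_out_edges[OF G, of v] b(2) by linarith
  show "card {e \<in> edges G. v \<in> fst e} \<le> 2 * card (verts G)" if "oriented G"
    using le card_in_edges[OF G, of v] card_out_edges_oriented[OF G that, of v] b(1) by linarith
qed

section \<open>Maximising \<open>b * (a choose 2)\<close>\<close>

text \<open>The choice \<open>b = n div 3\<close>, \<open>a = n - b\<close>; here
  \<open>n - n div 3\<close> is the ceiling of \<open>2 n / 3\<close>.\<close>

definition max_edges :: "nat \<Rightarrow> nat" where
  "max_edges n = (n div 3) * ((n - n div 3) choose 2)"

text \<open>The maximisers \<open>b\<close> for \<open>n \<ge> 3\<close>. For
  \<open>n = 3 k + 2\<close> there is a tie: \<open>b = k\<close> and \<open>b = k + 1\<close> both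
  give \<open>k (k + 1) (2 k + 1)\<close>.\<close>

definition optimal_head_counts :: "nat \<Rightarrow> nat set" where
  "optimal_head_counts n = (if n mod 3 = 2 then {n div 3, n div 3 + 1} else {n div 3})"

lemma two_choose_two: "2 * int (a choose 2) = int a * (int a - 1)"
  by (induction a) (auto simp: numeral_2_eq_2 algebra_simps)

text \<open>With \<open>n = 3 K + R\<close> and \<open>b = K + T\<close>, the polynomial below is twice the loss
  against \<open>b = K\<close>.\<close>

lemma edge_loss_polynomial:
  fixes K R T :: int
  assumes "1 \<le> K" "R = 0 \<or> R = 1 \<or> R = 2" "- K \<le> T" "T \<le> 2 * K + R"
  defines "D \<equiv> K * ((2 * K + R) * (2 * K + R - 1)) - (K + T) * ((2 * K + R - T) * (2 * K + R - T - 1))"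
  shows "D \<ge> 0" "D = 0 \<longleftrightarrow> T = 0 \<or> (R = 2 \<and> T = 1)"
proof -
  \<comment> \<open>The loss vanishes at \<open>T = 0\<close>; \<open>I\<close> is its cofactor, so
    the claim is that \<open>I\<close> has the sign of \<open>T\<close>, except at the second
    optimum.\<close>
  define I where "I = (1 - R) * (2 * K + R) - K + T * (3 * K + 2 * R - 1 - T)"
  have D: "D = T * I" unfolding D_def I_def by algebra
  have neg: "I < 0" if "T \<le> -1"
  proof -
    have *: "T * x \<le> - x" if "x \<ge> 0" for x
      using mult_right_mono[OF \<open>T \<le> -1\<close> that] by simp
    show ?thesis
      using assms(1,2) that *[of "3 * K + 2 * R - 1 - T"] unfolding I_def by auto
  qed
  have pos: "I > 0" if "T \<ge> 1" "\<not> (R = 2 \<and> T = 1)"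
  proof -
    consider "R = 0" | "R = 1" | "R = 2" using assms(2) by blast
    then show ?thesis
    proof cases
      case 1
      have "T * (3 * K - 1 - T) \<ge> 0" using that assms 1 by (intro mult_nonneg_nonneg) auto
      then show ?thesis using 1 assms(1) by (simp add: I_def)
    next
      case 2
      have "3 * K + 1 - T \<le> T * (3 * K + 1 - T)"
        using mult_right_mono[of 1 T "3 * K + 1 - T"] that assms 2 by simp
      \<comment> \<open>At this endpoint no vertex remains on the tail side and the second factor is
        only \<open>K\<close>, so the factor \<open>T\<close> has to supply the strict
        inequality.\<close>
      moreover have "T = 2 * K + 1 \<longrightarrow> T * (3 * K + 1 - T) > K"
        using assms(1) by (auto simp: algebra_simps)
      moreover have "T \<noteq> 2 * K + 1 \<longrightarrow> 3 * K + 1 - T > K" using 2 assms(4) by linarith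
      ultimately have "T * (3 * K + 1 - T) > K" by (meson order.strict_trans2)
      then show ?thesis unfolding I_def 2 by (simp add: algebra_simps)
    next
      case 3
      \<comment> \<open>The root \<open>T = 1\<close> is the second optimum.\<close>
      have "I = (T - 1) * (3 * K + 2 - T)" unfolding I_def 3 by (simp add: algebra_simps)
      also have "\<dots> > 0" using that 3 assms by (intro mult_pos_pos) auto
      finally show ?thesis .
    qed
  qed
  have zero: "I = 0" if "R = 2" "T = 1" using that by (simp add: I_def)
  consider "T = 0" | "T \<le> -1" | "R = 2 \<and> T = 1" | "T \<ge> 1" "\<not> (R = 2 \<and> T = 1)" by linarith
  then have "D \<ge> 0 \<and> (D = 0 \<longleftrightarrow> T = 0 \<or> (R = 2 \<and> T = 1))"
  proof cases
    case 2
    then have "D > 0" using neg unfolding D by (simp add: mult_neg_neg)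
    then show ?thesis using 2 by auto
  next
    case 4
    then have "D > 0" using pos unfolding D by simp
    then show ?thesis using 4 by auto
  qed (use zero D in auto)
  then show "D \<ge> 0" "D = 0 \<longleftrightarrow> T = 0 \<or> (R = 2 \<and> T = 1)" by auto
qed

lemma split_edges_le_max_edges:
  assumes n: "a + b = n" and n3: "3 \<le> n"
  shows "b * (a choose 2) \<le> max_edges n"
    and "b * (a choose 2) = max_edges n \<longleftrightarrow> b \<in> optimal_head_counts n"
proof -
  \<comment> \<open>Integers let the deviation \<open>T\<close> from \<open>n div 3\<close> be
    negative; doubling below clears the binomial coefficients.\<close>
  define K R T where "K = int (n div 3)" and "R = int (n mod 3)" and "T = int b - K"
  have nKR: "int n = 3 * K + R" unfolding K_def R_def by presburger
  have c: "int (n - n div 3) = 2 * K + R" using nKR unfolding K_def by linarith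
  have a: "int a = 2 * K + R - T" using nKR n unfolding T_def by linarith
  have b: "int b = K + T" unfolding T_def by simp
  have "2 * int (max_edges n) = K * (2 * int (n - n div 3 choose 2))"
    unfolding max_edges_def K_def by simp
  then have g: "2 * int (max_edges n) = K * ((2 * K + R) * (2 * K + R - 1))"
    unfolding two_choose_two c .
  have "2 * int (b * (a choose 2)) = int b * (2 * int (a choose 2))" by simp
  then have f: "2 * int (b * (a choose 2)) = (K + T) * ((2 * K + R - T) * (2 * K + R - T - 1))"
    unfolding two_choose_two a b .
  have "1 \<le> K" using n3 unfolding K_def by presburger
  moreover have R: "R = 0 \<or> R = 1 \<or> R = 2" unfolding R_def by presburger
  moreover have "- K \<le> T" "T \<le> 2 * K + R" using a b by linarith+
  ultimately have D: "2 * int (max_edges n) - 2 * int (b * (a choose 2)) \<ge> 0"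
    "2 * int (max_edges n) - 2 * int (b * (a choose 2)) = 0 \<longleftrightarrow> T = 0 \<or> (R = 2 \<and> T = 1)"
    unfolding g f by (rule edge_loss_polynomial)+
  show "b * (a choose 2) \<le> max_edges n" using D(1) by linarith
  have "b \<in> optimal_head_counts n \<longleftrightarrow> T = 0 \<or> (R = 2 \<and> T = 1)"
    unfolding optimal_head_counts_def T_def R_def K_def by auto
  moreover have "b * (a choose 2) = max_edges n \<longleftrightarrow>
      2 * int (max_edges n) - 2 * int (b * (a choose 2)) = 0" by linarith
  ultimately show "b * (a choose 2) = max_edges n \<longleftrightarrow> b \<in> optimal_head_counts n"
    using D(2) by blast
qed

section \<open>Growth of \<open>max_edges\<close>\<close>

text \<open>In each residue class \<open>max_edges\<close> is a cubic, so the growth estimates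
  become polynomial inequalities in \<open>k\<close>.\<close>

lemma max_edges_mod_3:
  "int (max_edges (3 * k)) = int k * int k * (2 * int k - 1)"
  "int (max_edges (3 * k + 1)) = int k * int k * (2 * int k + 1)"
  "int (max_edges (3 * k + 2)) = int k * (int k + 1) * (2 * int k + 1)"
proof -
  have d: "3 * k div 3 = k" "(3 * k + 1) div 3 = k" "(3 * k + 2) div 3 = k"
    "3 * k - k = 2 * k" "3 * k + 1 - k = 2 * k + 1" "3 * k + 2 - k = 2 * k + 2" by auto
  have g: "2 * int (k * (c choose 2)) = int k * (int c * (int c - 1))" for c
    using two_choose_two[of c] by (simp add: mult.left_commute)
  have "2 * int (max_edges (3 * k)) = 2 * (int k * int k * (2 * int k - 1))"
    unfolding max_edges_def d g by (simp add: algebra_simps)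
  then show "int (max_edges (3 * k)) = int k * int k * (2 * int k - 1)" by simp
  have "2 * int (max_edges (3 * k + 1)) = 2 * (int k * int k * (2 * int k + 1))"
    unfolding max_edges_def d g by (simp add: algebra_simps)
  then show "int (max_edges (3 * k + 1)) = int k * int k * (2 * int k + 1)" by simp
  have "2 * int (max_edges (3 * k + 2)) = 2 * (int k * (int k + 1) * (2 * int k + 1))"
    unfolding max_edges_def d g by (simp add: algebra_simps)
  then show "int (max_edges (3 * k + 2)) = int k * (int k + 1) * (2 * int k + 1)" by simp
qed

lemma mod_3_cases:
  obtains k :: nat where "n = 3 * k" | k where "n = 3 * k + 1" | k where "n = 3 * k + 2"
proof -
  have "n = 3 * (n div 3) \<or> n = 3 * (n div 3) + 1 \<or> n = 3 * (n div 3) + 2" by presburger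
  then show thesis using that by blast
qed

text \<open>This is monotonicity of \<open>max_edges n / n\<close> with cleared denominators. In
  each residue class the difference of the two sides is the product stated to be
  nonnegative.\<close>

lemma max_edges_ratio_step: "(n + 1) * max_edges n \<le> n * max_edges (n + 1)"
proof -
  have "(int n + 1) * int (max_edges n) \<le> int n * int (max_edges (n + 1))"
  proof (cases n rule: mod_3_cases)
    case (1 k)
    have "0 \<le> int k * int k * (4 * int k + 1)" by simp
    then show ?thesis unfolding 1 max_edges_mod_3 by (simp add: algebra_simps)
  next
    case (2 k)
    have "0 \<le> int k * (2 * int k + 1) * (2 * int k + 1)" by simp
    then have "(3 * int k + 2) * (int k * int k * (2 * int k + 1))
        \<le> (3 * int k + 1) * (int k * (int k + 1) * (2 * int k + 1))" by (simp add: algebra_simps)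
    moreover have "n + 1 = 3 * k + 2" using 2 by simp
    ultimately show ?thesis unfolding \<open>n + 1 = 3 * k + 2\<close> unfolding 2 max_edges_mod_3
      by (simp add: algebra_simps)
  next
    case (3 k)
    have 31: "n + 1 = 3 * (k + 1)" using 3 by simp
    have "0 \<le> (int k + 1) * (2 * int k + 1) * (2 * int k + 2)" by simp
    then show ?thesis unfolding 31 unfolding 3 max_edges_mod_3 by (simp add: algebra_simps)
  qed
  then have "int ((n + 1) * max_edges n) \<le> int (n * max_edges (n + 1))" by (simp add: algebra_simps)
  then show ?thesis by linarith
qed

lemma max_edges_ratio_mono:
  assumes "s \<le> n"
  shows "n * max_edges s \<le> s * max_edges n"
  using assms
proof (induction n rule: dec_induct)
  case (step n)
  show ?case
  \<comment> \<open>The induction step cancels a factor \<open>n\<close>, so \<open>n = 0\<close> is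
    separate.\<close>
  proof (cases "n = 0")
    case False
    have "n * (Suc n * max_edges s) = Suc n * (n * max_edges s)" by (rule mult.left_commute)
    also have "\<dots> \<le> Suc n * (s * max_edges n)" using step.IH by (rule mult_le_mono2)
    also have "\<dots> = s * ((n + 1) * max_edges n)" by (simp add: algebra_simps)
    also have "\<dots> \<le> s * (n * max_edges (n + 1))" using max_edges_ratio_step by (rule mult_le_mono2)
    also have "\<dots> = n * (s * max_edges (Suc n))" by simp
    finally show ?thesis using False by simp
  qed (use step in \<open>simp add: max_edges_def\<close>)
qed simp

text \<open>The range starts where it must: for 28 the two sides are 1568 and 1539, for 29 they are
  1682 and 1710.\<close>

lemma two_square_less_max_edges: "n * (2 * n) < max_edges n" if "29 \<le> n"
proof -
  have "int n * (2 * int n) < int (max_edges n)"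
  proof (cases n rule: mod_3_cases)
    case (1 k)
    then have "20 \<le> 2 * int k" using that by simp
    then have "int k * int k * 18 < int k * int k * (2 * int k - 1)"
      by (intro mult_strict_left_mono) auto
    then show ?thesis unfolding 1 max_edges_mod_3 by (simp add: algebra_simps)
  next
    case (2 k)
    then have "10 \<le> k" using that by simp
    \<comment> \<open>After the shift by the least admissible \<open>k\<close>, the difference of
      the two sides is a polynomial in \<open>j\<close> with positive coefficients only. The later
      shifts serve the same purpose.\<close>
    then obtain j where j: "k = 10 + j" using le_Suc_ex by blast
    show ?thesis unfolding 2 max_edges_mod_3 unfolding j by (simp add: algebra_simps add_pos_nonneg add_nonneg_pos)
  next
    case (3 k)
    then have "9 \<le> k" using that by simp
    then obtain j where j: "k = 9 + j" using le_Suc_ex by blast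
    show ?thesis unfolding 3 max_edges_mod_3 unfolding j by (simp add: algebra_simps add_pos_nonneg add_nonneg_pos)
  qed
  then have "int (n * (2 * n)) < int (max_edges n)" by simp
  then show ?thesis by linarith
qed

lemma four_square_less_max_edges: "n * (4 * n) < max_edges n" if "70 \<le> n"
proof -
  have "int n * (4 * int n) < int (max_edges n)"
  proof (cases n rule: mod_3_cases)
    case (1 k)
    then have "48 \<le> 2 * int k" using that by simp
    then have "int k * int k * 36 < int k * int k * (2 * int k - 1)"
      by (intro mult_strict_left_mono) auto
    then show ?thesis unfolding 1 max_edges_mod_3 by (simp add: algebra_simps)
  next
    case (2 k)
    then have "23 \<le> k" using that by simp
    then obtain j where j: "k = 23 + j" using le_Suc_ex by blast
    show ?thesis unfolding 2 max_edges_mod_3 unfolding j by (simp add: algebra_simps add_pos_nonneg add_nonneg_pos)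
  next
    case (3 k)
    then have "23 \<le> k" using that by simp
    then obtain j where j: "k = 23 + j" using le_Suc_ex by blast
    show ?thesis unfolding 3 max_edges_mod_3 unfolding j by (simp add: algebra_simps add_pos_nonneg add_nonneg_pos)
  qed
  then have "int (n * (4 * n)) < int (max_edges n)" by simp
  then show ?thesis by linarith
qed

section \<open>The extremal graphs\<close>

definition split_graph :: "'a set \<Rightarrow> 'a set \<Rightarrow> 'a dhgraph" where
  "split_graph A B = \<lparr>verts = A \<union> B,
     edges = (\<lambda>(P, z). (insert z P, z)) ` ({P. P \<subseteq> A \<and> card P = 2} \<times> B)\<rparr>"

lemma verts_split_graph [simp]: "verts (split_graph A B) = A \<union> B"
  by (simp add: split_graph_def)

lemma edge_split_graph_iff:
  assumes "A \<inter> B = {}"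
  shows "(S, h) \<in> edges (split_graph A B) \<longleftrightarrow> h \<in> B \<and> h \<in> S \<and> S - {h} \<subseteq> A \<and> card (S - {h}) = 2"
proof
  assume "(S, h) \<in> edges (split_graph A B)"
  then obtain P where P: "S = insert h P" "P \<subseteq> A" "card P = 2" "h \<in> B"
    by (auto simp: split_graph_def)
  moreover have "S - {h} = P" using P assms by auto
  ultimately show "h \<in> B \<and> h \<in> S \<and> S - {h} \<subseteq> A \<and> card (S - {h}) = 2" by auto
next
  assume *: "h \<in> B \<and> h \<in> S \<and> S - {h} \<subseteq> A \<and> card (S - {h}) = 2"
  then have mem: "(S - {h}, h) \<in> {P. P \<subseteq> A \<and> card P = 2} \<times> B" by auto
  have eq: "(S, h) = (\<lambda>(P, z). (insert z P, z)) (S - {h}, h)" using * by auto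
  show "(S, h) \<in> edges (split_graph A B)"
    unfolding split_graph_def dhgraph.simps by (rule image_eqI[OF _ mem]) (rule eq)
qed

lemma arrow_split_graph_iff:
  assumes "A \<inter> B = {}"
  shows "arrow a b c \<in> edges (split_graph A B) \<longleftrightarrow> a \<in> A \<and> b \<in> A \<and> a \<noteq> b \<and> c \<in> B"
proof -
  have "{a, b, c} - {c} = {a, b} - {c}" by auto
  then show ?thesis
    using assms unfolding arrow_def edge_split_graph_iff[OF assms]
    by (cases "a = c"; cases "b = c"; cases "a = b") (auto simp: insert_Diff_if)
qed

lemma card_edges_split_graph:
  assumes "A \<inter> B = {}" "finite A"
  shows "card (edges (split_graph A B)) = card B * (card A choose 2)"
proof -
  have "inj_on (\<lambda>(P, z). (insert z P, z)) ({P. P \<subseteq> A \<and> card P = 2} \<times> B)"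
    by (rule inj_on_inverseI[where g = "\<lambda>(S, z). (S - {z}, z)"]) (use assms(1) in auto)
  then have "card (edges (split_graph A B)) = card ({P. P \<subseteq> A \<and> card P = 2} \<times> B)"
    unfolding split_graph_def by (simp add: card_image)
  then show ?thesis using n_subsets[OF assms(2), of 2] by (simp add: card_cartesian_product)
qed

lemma dhgraph_split_graph:
  assumes "A \<inter> B = {}" "finite A" "finite B"
  shows "dhgraph (split_graph A B)"
proof -
  have "S \<subseteq> A \<union> B \<and> card S = 3 \<and> h \<in> S" if "(S, h) \<in> edges (split_graph A B)" for S h
  proof -
    have *: "h \<in> B" "h \<in> S" "S - {h} \<subseteq> A" "card (S - {h}) = 2"
      using that unfolding edge_split_graph_iff[OF assms(1)] by auto
    then have "finite S" by (metis card.infinite finite_Diff_insert finite.emptyI finite_Diff2 zero_neq_numeral)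
    then have "card S = 3" using * by (simp add: card_Diff_singleton)
    then show ?thesis using * by auto
  qed
  then show ?thesis using assms unfolding dhgraph_def by auto
qed

text \<open>The head of an edge is the only vertex of its underlying set in
  \<open>B\<close>.\<close>

lemma oriented_split_graph:
  assumes "A \<inter> B = {}"
  shows "oriented (split_graph A B)"
  unfolding oriented_def
proof (intro allI impI)
  fix S assume "S \<subseteq> verts (split_graph A B) \<and> card S = 3"
  have "e = f" if "e \<in> {e \<in> edges (split_graph A B). fst e = S}"
    "f \<in> {e \<in> edges (split_graph A B). fst e = S}" for e f
    using that assms by (cases e; cases f) (auto simp: edge_split_graph_iff[OF assms])
  \<comment> \<open>As \<open>A\<close> and \<open>B\<close> may be infinite here, the default
    cardinality 0 of an infinite set is covered as well.\<close>
  then show "card {e \<in> edges (split_graph A B). fst e = S} \<le> 1"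
    by (cases "finite {e \<in> edges (split_graph A B). fst e = S}")
      (simp_all only: card_le_Suc0_iff_eq One_nat_def card.infinite, blast, simp)
qed

text \<open>The middle vertex of a copy would lie in \<open>B\<close> as a head and in
  \<open>A\<close> as a tail.\<close>

lemma R4_free_split_graph:
  assumes "A \<inter> B = {}"
  shows "dh_free R4 (split_graph A B)"
  using assms unfolding dh_free_def dh_hom_R4_iff arrow_split_graph_iff[OF assms] by blast

lemma dh_iso_split_graph:
  assumes fin: "finite A" "finite B" "finite A'" "finite B'"
    and disj: "A \<inter> B = {}" "A' \<inter> B' = {}"
    and card: "card A = card A'" "card B = card B'"
  shows "dh_iso (split_graph A B) (split_graph A' B')"
proof -
  obtain f g where f: "bij_betw f A A'" and g: "bij_betw g B B'"
    using fin card finite_same_card_bij by metis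
  define \<phi> where "\<phi> x = (if x \<in> A then f x else g x)" for x
  have fA: "bij_betw \<phi> A A'" using f by (subst bij_betw_cong[of _ _ f]) (auto simp: \<phi>_def)
  have gB: "bij_betw \<phi> B B'" using g disj(1) by (subst bij_betw_cong[of _ _ g]) (auto simp: \<phi>_def)
  have bij: "bij_betw \<phi> (A \<union> B) (A' \<union> B')" using fA gB disj(2) by (rule bij_betw_combine)
  have A: "\<phi> x \<in> A' \<longleftrightarrow> x \<in> A" and B: "\<phi> x \<in> B' \<longleftrightarrow> x \<in> B" if "x \<in> A \<union> B" for x
    using that fA gB disj by (auto dest: bij_betwE)
  have "arrow a b c \<in> edges (split_graph A B) \<longleftrightarrow>
      arrow (\<phi> a) (\<phi> b) (\<phi> c) \<in> edges (split_graph A' B')"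
    if "a \<in> A \<union> B" "b \<in> A \<union> B" "c \<in> A \<union> B" for a b c
    using that A B inj_on_eq_iff[OF bij_betw_imp_inj_on[OF bij], of a b]
    unfolding arrow_split_graph_iff[OF disj(1)] arrow_split_graph_iff[OF disj(2)] by blast
  then show ?thesis unfolding dh_iso_def using bij
    by (intro exI[of _ \<phi>]) auto
qed

text \<open>Stated through \<open>arrow\<close> on vertices, in the same form as
  \<open>dh_iso\<close>, to make its size an evident isomorphism invariant.\<close>

definition heads :: "'a dhgraph \<Rightarrow> 'a set" where
  "heads G = {c \<in> verts G. \<exists>a \<in> verts G. \<exists>b \<in> verts G. arrow a b c \<in> edges G}"

lemma dh_iso_card_heads:
  assumes "dh_iso G H"
  shows "card (heads G) = card (heads H)"
proof -
  obtain \<phi> where bij: "bij_betw \<phi> (verts G) (verts H)"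
    and iso: "\<And>a b c. a \<in> verts G \<Longrightarrow> b \<in> verts G \<Longrightarrow> c \<in> verts G \<Longrightarrow>
       arrow a b c \<in> edges G \<longleftrightarrow> arrow (\<phi> a) (\<phi> b) (\<phi> c) \<in> edges H"
    using assms unfolding dh_iso_def by blast
  have im: "verts H = \<phi> ` verts G" using bij by (simp add: bij_betw_def)
  have "heads H = \<phi> ` heads G" unfolding heads_def im using iso by blast
  moreover have "inj_on \<phi> (heads G)"
    using bij_betw_imp_inj_on[OF bij] by (rule inj_on_subset) (auto simp: heads_def)
  ultimately show ?thesis by (simp add: card_image)
qed

lemma heads_split_graph:
  assumes "A \<inter> B = {}" "2 \<le> card A"
  shows "heads (split_graph A B) = B"
proof -
  obtain P where "P \<subseteq> A" "card P = 2" using assms(2) by (meson obtain_subset_with_card_n)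
  then obtain a b where "a \<in> A" "b \<in> A" "a \<noteq> b" by (auto simp: card_2_iff)
  then show ?thesis
    unfolding heads_def arrow_split_graph_iff[OF assms(1)] by auto
qed

section \<open>The upper bound\<close>

text \<open>Keeping the degree bound \<open>K\<close> abstract serves the oriented and the standard
  case at once. The condition on \<open>K\<close> says that a mixed vertex contributes less than the
  average \<open>max_edges n / n\<close>.\<close>

lemma R4_free_edges_bound:
  assumes G: "dhgraph G" and n: "card (verts G) = n" "3 \<le> n"
    and mixed: "\<And>v. v \<in> verts G \<Longrightarrow> in_link G v \<noteq> {} \<Longrightarrow> out_link G v \<noteq> {} \<Longrightarrow>
       card {e \<in> edges G. v \<in> fst e} \<le> K"
    and K: "n * K < max_edges n"
  shows "card (edges G) \<le> max_edges n"
    and "card (edges G) = max_edges n \<Longrightarrow> \<exists>A B. finite A \<and> finite B \<and> A \<inter> B = {} \<and>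
       card A + card B = n \<and> card B \<in> optimal_head_counts n \<and> G = split_graph A B"
proof -
  \<comment> \<open>Vertices in no edge go to \<open>A\<close>, so the three sets partition the
    vertices.\<close>
  define A where "A = {v \<in> verts G. in_link G v = {}}"
  define B where "B = {v \<in> verts G. in_link G v \<noteq> {} \<and> out_link G v = {}}"
  define C where "C = {v \<in> verts G. in_link G v \<noteq> {} \<and> out_link G v \<noteq> {}}"
  have finV: "finite (verts G)" using G by (simp add: dhgraph_def)
  have fin: "finite A" "finite B" "finite C" using finV by (auto simp: A_def B_def C_def)
  have disj: "A \<inter> B = {}" "(A \<union> B) \<inter> C = {}" by (auto simp: A_def B_def C_def)
  have V: "verts G = A \<union> B \<union> C" by (auto simp: A_def B_def C_def)
  have cards: "card A + card B + card C = n"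
    using n fin disj unfolding V by (simp add: card_Un_disjoint)
  have split: "{e \<in> edges G. fst e \<inter> C = {}} \<subseteq> edges (split_graph A B)"
  proof
    fix e assume e: "e \<in> {e \<in> edges G. fst e \<inter> C = {}}"
    obtain S h where Sh: "e = (S, h)" by (cases e)
    then have edge: "(S, h) \<in> edges G" and C: "S \<inter> C = {}" using e by auto
    note S = dhgraph_edgeD[OF G edge]
    \<comment> \<open>A head has a nonempty in-link and a tail a nonempty out-link; outside
      \<open>C\<close> this puts them in \<open>B\<close> and \<open>A\<close>.\<close>
    have "in_link G h \<noteq> {}" using edge by (auto simp: in_link_def)
    then have "h \<in> B" using S C by (auto simp: B_def C_def)
    moreover have "x \<in> A" if "x \<in> S - {h}" for x
    proof -
      have "out_link G x \<noteq> {}" using edge that by (auto simp: out_link_def)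
      then show ?thesis using S C that by (auto simp: A_def C_def)
    qed
    ultimately show "e \<in> edges (split_graph A B)"
      unfolding Sh edge_split_graph_iff[OF disj(1)] using S by auto
  qed
  have finS: "finite (edges (split_graph A B))"
    using dhgraph_split_graph[OF disj(1) fin(1,2)] by (rule finite_edges)
  have "edges G \<subseteq> {e \<in> edges G. fst e \<inter> C = {}} \<union> (\<Union>v\<in>C. {e \<in> edges G. v \<in> fst e})" by auto
  then have "card (edges G) \<le> card ({e \<in> edges G. fst e \<inter> C = {}} \<union> (\<Union>v\<in>C. {e \<in> edges G. v \<in> fst e}))"
    using finite_edges[OF G] fin by (intro card_mono) auto
  also have "\<dots> \<le> card {e \<in> edges G. fst e \<inter> C = {}} + card (\<Union>v\<in>C. {e \<in> edges G. v \<in> fst e})"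
    by (rule card_Un_le)
  also have "card {e \<in> edges G. fst e \<inter> C = {}} \<le> card (edges (split_graph A B))"
    using finS split by (rule card_mono)
  also have "card (\<Union>v\<in>C. {e \<in> edges G. v \<in> fst e}) \<le> (\<Sum>v\<in>C. card {e \<in> edges G. v \<in> fst e})"
    using fin by (intro card_UN_le)
  also have "\<dots> \<le> (\<Sum>v\<in>C. K)" using mixed by (intro sum_mono) (auto simp: C_def)
  finally have bound: "card (edges G) \<le> card B * (card A choose 2) + card C * K"
    by (simp add: card_edges_split_graph[OF disj(1) fin(1)])
  have "card (edges G) \<le> max_edges n \<and> (card (edges G) = max_edges n \<longrightarrow> (\<exists>A B. finite A \<and> finite B \<and>
       A \<inter> B = {} \<and> card A + card B = n \<and> card B \<in> optimal_head_counts n \<and> G = split_graph A B))"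
  proof (cases "C = {}")
    case True
    have AB: "card A + card B = n" using cards True by simp
    note opt = split_edges_le_max_edges[OF AB n(2)]
    have "card (edges G) \<le> max_edges n" using bound opt(1) True by simp
    moreover have "card B \<in> optimal_head_counts n \<and> G = split_graph A B" if eq: "card (edges G) = max_edges n"
    proof
      have le: "max_edges n = card B * (card A choose 2)" using bound opt(1) True eq by simp
      then show "card B \<in> optimal_head_counts n" using opt(2) by simp
      have "edges G = edges (split_graph A B)"
        using split le eq True by (intro card_subset_eq[OF finS])
          (auto simp: card_edges_split_graph[OF disj(1) fin(1)])
      then show "G = split_graph A B"
        using V True by (intro dhgraph.equality) auto
    qed
    ultimately show ?thesis using AB fin disj(1) by blast
  next
    case False
    define s where "s = card A + card B"
    have s: "s + card C = n" "0 < card C" using cards False fin by (auto simp: s_def)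
    have "card B * (card A choose 2) \<le> max_edges s"
    proof (cases "3 \<le> s")
      case True
      then show ?thesis by (rule split_edges_le_max_edges(1)[OF s_def[symmetric]])
    next
      case small: False
      \<comment> \<open>With at most two vertices, \<open>A\<close> contains no pair or
        \<open>B\<close> is empty.\<close>
      then have "card B * (card A choose 2) = 0"
        by (cases "card A \<le> 1") (auto simp: s_def binomial_eq_0)
      then show ?thesis by (simp only: zero_le)
    qed
    then have "n * card (edges G) \<le> n * (max_edges s + card C * K)"
      using bound by (intro mult_le_mono2) linarith
    also have "\<dots> = n * max_edges s + card C * (n * K)" by (simp add: algebra_simps)
    \<comment> \<open>The ratio bound handles the \<open>s\<close> vertices outside
      \<open>C\<close>; strictness comes from \<open>n * K < max_edges n\<close>, used once for each
      vertex of the nonempty set \<open>C\<close>.\<close>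
    also have "\<dots> < s * max_edges n + card C * max_edges n"
      using max_edges_ratio_mono[of s n] s K by (intro add_le_less_mono) auto
    also have "\<dots> = n * max_edges n" using s(1) by (simp flip: distrib_right)
    finally show ?thesis by simp
  qed
  then show "card (edges G) \<le> max_edges n"
    and "card (edges G) = max_edges n \<Longrightarrow> \<exists>A B. finite A \<and> finite B \<and> A \<inter> B = {} \<and>
       card A + card B = n \<and> card B \<in> optimal_head_counts n \<and> G = split_graph A B" by blast+
qed

section \<open>Counting isomorphism classes\<close>

text \<open>When \<open>f\<close> is a complete invariant, the classes are its nonempty
  fibres.\<close>

lemma card_quotient_of_invariant:
  fixes f :: "'a \<Rightarrow> 'b"
  assumes "\<And>x y. x \<in> X \<Longrightarrow> y \<in> X \<Longrightarrow> (x, y) \<in> r \<longleftrightarrow> f x = f y" "r \<subseteq> X \<times> X"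
  shows "card (X // r) = card (f ` X)"
proof -
  have cls: "r `` {x} = {y \<in> X. f y = f x}" if "x \<in> X" for x
    using assms that by auto
  have "X // r = (\<lambda>c. {y \<in> X. f y = c}) ` f ` X"
    unfolding quotient_def by (auto simp: cls)
  moreover have "inj_on (\<lambda>c. {y \<in> X. f y = c}) (f ` X)"
    by (rule inj_onI) blast
  ultimately show ?thesis by (simp add: card_image)
qed

text \<open>On the extremal graphs the number of heads is a complete isomorphism invariant, and it
  takes exactly the values in \<open>optimal_head_counts n\<close>.\<close>

lemma Max_and_iso_classes:
  fixes X :: "nat dhgraph set"
  assumes n: "6 \<le> n"
    and ub: "\<And>G. G \<in> X \<Longrightarrow> card (edges G) \<le> max_edges n"
    and extr: "\<And>G. G \<in> X \<Longrightarrow> card (edges G) = max_edges n \<Longrightarrow>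
       \<exists>A B. finite A \<and> finite B \<and> A \<inter> B = {} \<and> card A + card B = n \<and>
         card B \<in> optimal_head_counts n \<and> G = split_graph A B"
    and mem: "\<And>A B. finite A \<Longrightarrow> finite B \<Longrightarrow> A \<inter> B = {} \<Longrightarrow> card A + card B = n \<Longrightarrow>
       split_graph A B \<in> X"
  shows "Max ((\<lambda>G. card (edges G)) ` X) = max_edges n"
    and "num_iso_classes {G \<in> X. card (edges G) = max_edges n} = card (optimal_head_counts n)"
proof -
  \<comment> \<open>This leaves at least two vertices in \<open>A\<close>, so that every vertex of
    \<open>B\<close> really is a head.\<close>
  have opt_le: "b + 2 \<le> n" if "b \<in> optimal_head_counts n" for b
    using that n by (auto simp: optimal_head_counts_def split: if_splits)
  have ex: "\<exists>G\<in>X. card (edges G) = max_edges n \<and> card (heads G) = b" if b: "b \<in> optimal_head_counts n" for b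
  proof -
    define A B where "A = {..<n - b}" and "B = {n - b..<n}"
    have AB: "finite A" "finite B" "A \<inter> B = {}" "card A + card B = n" "card B = b" "2 \<le> card A"
      using opt_le[OF b] by (auto simp: A_def B_def)
    have "split_graph A B \<in> X" using AB mem by blast
    moreover have "card (edges (split_graph A B)) = max_edges n"
      using split_edges_le_max_edges(2)[OF AB(4)] AB b n by (simp add: card_edges_split_graph)
    moreover have "heads (split_graph A B) = B" using AB by (intro heads_split_graph)
    ultimately show ?thesis using AB by auto
  qed
  have b: "n div 3 \<in> optimal_head_counts n" by (simp add: optimal_head_counts_def)
  show "Max ((\<lambda>G. card (edges G)) ` X) = max_edges n"
  proof (rule Max_eqI)
    \<comment> \<open>The set \<open>X\<close> is infinite, as it contains split graphs on arbitrary
      \<open>n\<close>-sets of naturals; only the edge counts are bounded.\<close>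
    show "finite ((\<lambda>G. card (edges G)) ` X)"
      by (rule finite_subset[of _ "{..max_edges n}"]) (use ub in auto)
    show "max_edges n \<in> (\<lambda>G. card (edges G)) ` X" using ex[OF b] by force
  qed (use ub in auto)
  let ?Y = "{G \<in> X. card (edges G) = max_edges n}"
  have card_heads: "\<exists>A B. finite A \<and> finite B \<and> A \<inter> B = {} \<and> card A + card B = n \<and>
      card B \<in> optimal_head_counts n \<and> card (heads G) = card B \<and> G = split_graph A B" if "G \<in> ?Y" for G
  proof -
    have "G \<in> X" "card (edges G) = max_edges n" using that by auto
    from extr[OF this] obtain A B where AB: "finite A" "finite B" "A \<inter> B = {}" "card A + card B = n"
      "card B \<in> optimal_head_counts n" "G = split_graph A B" by blast
    have "2 \<le> card A" using opt_le[OF AB(5)] AB(4) by simp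
    then have "heads G = B" unfolding AB(6) by (rule heads_split_graph[OF AB(3)])
    then show ?thesis using AB by blast
  qed
  have "card (?Y // {(G, H). G \<in> ?Y \<and> H \<in> ?Y \<and> dh_iso G H}) = card ((\<lambda>G. card (heads G)) ` ?Y)"
  proof (rule card_quotient_of_invariant)
    fix G H assume GH: "G \<in> ?Y" "H \<in> ?Y"
    obtain A B where AB: "finite A" "finite B" "A \<inter> B = {}" "card A + card B = n"
      "card (heads G) = card B" "G = split_graph A B" using card_heads[OF GH(1)] by blast
    obtain A' B' where AB': "finite A'" "finite B'" "A' \<inter> B' = {}" "card A' + card B' = n"
      "card (heads H) = card B'" "H = split_graph A' B'" using card_heads[OF GH(2)] by blast
    have "dh_iso G H" if "card (heads G) = card (heads H)"
      unfolding AB(6) AB'(6) using AB AB' that by (intro dh_iso_split_graph) auto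
    then show "(G, H) \<in> {(G, H). G \<in> ?Y \<and> H \<in> ?Y \<and> dh_iso G H} \<longleftrightarrow> card (heads G) = card (heads H)"
      using GH dh_iso_card_heads by blast
  qed auto
  moreover have "(\<lambda>G. card (heads G)) ` ?Y = optimal_head_counts n"
  proof
    show "(\<lambda>G. card (heads G)) ` ?Y \<subseteq> optimal_head_counts n"
    proof (rule image_subsetI)
      fix G assume "G \<in> ?Y"
      from card_heads[OF this] show "card (heads G) \<in> optimal_head_counts n" by auto
    qed
    show "optimal_head_counts n \<subseteq> (\<lambda>G. card (heads G)) ` ?Y"
    proof
      fix b assume "b \<in> optimal_head_counts n"
      from ex[OF this] show "b \<in> (\<lambda>G. card (heads G)) ` ?Y" by auto
    qed
  qed
  ultimately show "num_iso_classes ?Y = card (optimal_head_counts n)"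
    unfolding num_iso_classes_def by simp
qed

section \<open>The oriented and the standard extremal numbers\<close>

lemma split_graph_mem:
  assumes "finite A" "finite B" "A \<inter> B = {}" "card A + card B = n"
  shows "split_graph A B \<in> free_graphs n R4" "split_graph A B \<in> free_oriented_graphs n R4"
  using assms dhgraph_split_graph[of A B] oriented_split_graph[of A B] R4_free_split_graph[of A B]
  by (auto simp: free_graphs_def free_oriented_graphs_def card_Un_disjoint)

lemma ex_ori_R4:
  assumes n: "29 \<le> n"
  shows "ex_ori n R4 = max_edges n"
    and "num_iso_classes (extremal_ori n R4) = card (optimal_head_counts n)"
proof -
  have *: "card (edges G) \<le> max_edges n \<and> (card (edges G) = max_edges n \<longrightarrow>
      (\<exists>A B. finite A \<and> finite B \<and> A \<inter> B = {} \<and> card A + card B = n \<and>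
        card B \<in> optimal_head_counts n \<and> G = split_graph A B))"
    if "G \<in> free_oriented_graphs n R4" for G
  proof -
    have G: "dhgraph G" "oriented G" "card (verts G) = n" "dh_free R4 G"
      using that by (auto simp: free_oriented_graphs_def)
    have "card {e \<in> edges G. v \<in> fst e} \<le> 2 * n"
      if "v \<in> verts G" "in_link G v \<noteq> {}" "out_link G v \<noteq> {}" for v
      using card_edges_at_mixed_vertex(2)[OF G(1,4) that(1) _ that(2,3) G(2)] G(3) n by simp
    \<comment> \<open>The degree bound is \<open>K = 2 * n\<close> here, and \<open>4 * n\<close> in
      the standard case.\<close>
    note b = R4_free_edges_bound[OF G(1,3) _ this two_square_less_max_edges[OF n]]
    show ?thesis using b n by simp
  qed
  note M = Max_and_iso_classes[of n "free_oriented_graphs n R4", OF _ _ _ split_graph_mem(2)]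
  show ex: "ex_ori n R4 = max_edges n"
    unfolding ex_ori_def by (rule M(1)) (use n * in auto)
  show "num_iso_classes (extremal_ori n R4) = card (optimal_head_counts n)"
    unfolding extremal_ori_def ex by (rule M(2)) (use n * in auto)
qed

lemma ex_std_R4:
  assumes n: "70 \<le> n"
  shows "ex_std n R4 = max_edges n"
    and "num_iso_classes (extremal_std n R4) = card (optimal_head_counts n)"
proof -
  have *: "card (edges G) \<le> max_edges n \<and> (card (edges G) = max_edges n \<longrightarrow>
      (\<exists>A B. finite A \<and> finite B \<and> A \<inter> B = {} \<and> card A + card B = n \<and>
        card B \<in> optimal_head_counts n \<and> G = split_graph A B))"
    if "G \<in> free_graphs n R4" for G
  proof -
    have G: "dhgraph G" "card (verts G) = n" "dh_free R4 G"
      using that by (auto simp: free_graphs_def)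
    have "card {e \<in> edges G. v \<in> fst e} \<le> 4 * n"
      if "v \<in> verts G" "in_link G v \<noteq> {}" "out_link G v \<noteq> {}" for v
      using card_edges_at_mixed_vertex(1)[OF G(1,3) that(1) _ that(2,3)] G(2) n by simp
    note b = R4_free_edges_bound[OF G(1,2) _ this four_square_less_max_edges[OF n]]
    show ?thesis using b n by simp
  qed
  note M = Max_and_iso_classes[of n "free_graphs n R4", OF _ _ _ split_graph_mem(1)]
  show ex: "ex_std n R4 = max_edges n"
    unfolding ex_std_def by (rule M(1)) (use n * in auto)
  show "num_iso_classes (extremal_std n R4) = card (optimal_head_counts n)"
    unfolding extremal_std_def ex by (rule M(2)) (use n * in auto)
qed

lemma max_edges_eq: "max_edges n = nat \<lfloor>real n / 3\<rfloor> * (nat \<lceil>2 * real n / 3\<rceil> choose 2)"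
proof -
  have "\<lfloor>real n / 3\<rfloor> = int (n div 3)" using floor_divide_of_nat_eq[of n 3] by simp
  moreover have "\<lceil>2 * real n / 3\<rceil> = int (n - n div 3)"
  proof (rule ceiling_unique)
    have "2 * n \<le> 3 * (n - n div 3)" "3 * (n - n div 3) < 2 * n + 3" by linarith+
    then have "real (2 * n) \<le> real (3 * (n - n div 3))" "real (3 * (n - n div 3)) < real (2 * n + 3)"
      unfolding of_nat_le_iff of_nat_less_iff .
    then have "2 * real n \<le> 3 * real (n - n div 3)" "3 * real (n - n div 3) < 2 * real n + 3"
      unfolding of_nat_mult of_nat_add of_nat_numeral .
    then show "of_int (int (n - n div 3)) - 1 < 2 * real n / 3"
      "2 * real n / 3 \<le> of_int (int (n - n div 3))" unfolding of_int_of_nat_eq by linarith+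
  qed
  ultimately show ?thesis by (simp only: max_edges_def nat_int)
qed

lemma card_optimal_head_counts: "card (optimal_head_counts n) = (if n mod 3 = 2 then 2 else 1)"
  by (simp add: optimal_head_counts_def)

theorem theorem1:
  shows "(\<forall>n::nat. n \<ge> 29 \<longrightarrow>
      ex_ori n R4 = nat \<lfloor>real n / 3\<rfloor> * (nat \<lceil>2 * real n / 3\<rceil> choose 2)
      \<and> (n mod 3 = 0 \<or> n mod 3 = 1 \<longrightarrow> num_iso_classes (extremal_ori n R4) = 1)
      \<and> (n mod 3 = 2 \<longrightarrow> num_iso_classes (extremal_ori n R4) = 2))
    \<and> (\<forall>n::nat. n \<ge> 70 \<longrightarrow>
      ex_std n R4 = nat \<lfloor>real n / 3\<rfloor> * (nat \<lceil>2 * real n / 3\<rceil> choose 2)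
      \<and> (n mod 3 = 0 \<or> n mod 3 = 1 \<longrightarrow> num_iso_classes (extremal_std n R4) = 1)
      \<and> (n mod 3 = 2 \<longrightarrow> num_iso_classes (extremal_std n R4) = 2))"
  using ex_ori_R4 ex_std_R4 by (simp add: card_optimal_head_counts flip: max_edges_eq)

end
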